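(* Let $D\subset\mathbb{R}^d$ $(d\geq 2)$ be a domain and let $\xi\in\partial D$ be a strongly convex boundary point. Then there exist a neighborhood $U$ of $\xi$ and $c_1,c_2>0$ such that for all $x\in D\cap U$ and $v\in\mathbb{R}^d$ $$k_D(x,v)\geq \left((1-c_1\delta_D(x))\frac{\|v_N\|^2}{4\delta_D(x)^2}+c_2\frac{\|v_T\|^2}{\delta_D(x)}\right)^{1/2}.$$
   Context: A domain is a connected open set; $\delta_D(x)$ is the Euclidean distance from $x$ to $\partial D$. A $\mathcal{C}^2$-smooth local defining function at $\xi\in\partial D$ is a $\mathcal{C}^2$ function $\rho\colon W\to\mathbb{R}$ on a neighborhood $W$ of $\xi$ with $D\cap W=\{\rho<0\}$, $\partial D\cap W=\{\rho=0\}$ and $\nabla\rho\neq0$ on $\partial D\cap W$; if one exists, $\xi$ is a $\mathcal{C}^2$-smooth boundary point, with unit outer normal $n_\xi:=\nabla\rho(\xi)/\|\nabla\rho(\xi)\|$ and tangent space $T_\xi\partial D:=\{v\in\mathbb{R}^d:\langle v,n_\xi\rangle=0\}$. The point $\xi$ is a strongly convex boundary point if for some (equivalently every) $\mathcal{C}^2$-smooth local defining function $\rho$ at $\xi$ the Hessian of $\rho$ at $\xi$ is positive definite on $T_\xi\partial D$. $U$ is taken small enough that every $x\in U$ has a unique nearest point $\pi(x)\in\partial D$, which is a $\mathcal{C}^2$-smooth boundary point; then $v_N:=\langle v,n_{\pi(x)}\rangle n_{\pi(x)}$ and $v_T:=v-v_N$. Kobayashi-Hilbert metric: with $I:=(-1,1)$,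 $$k_D(x,v):=\inf\{1/|r|: f\colon I\to D\text{ projective map},\ f(0)=x,\ f'(0)=rv\},$$ where a projective map is a map of the form $f(t)=\frac{a+tb}{1+ct}$ with $a,b\in\mathbb{R}^d$, $c\in\mathbb{R}$ and $1+ct\neq0$ on $I$. Explicitly, $k_D(x,v)=\frac12(\mathrm{Funk}(x,v)+\mathrm{Funk}(x,-v))$ with $\mathrm{Funk}(x,v):=\sup\{t>0:x+t^{-1}v\notin D\}$ and $\sup\varnothing=0$. *)

theory Defs
  imports "HOL-Analysis.Analysis"
begin

section \<open>Smooth boundary points\<close>

definition gradient :: "('a::euclidean_space \<Rightarrow> real) \<Rightarrow> 'a \<Rightarrow> 'a" where
  "gradient f x = (THE g. GDERIV f x :> g)"

text \<open>The Hessian as a linear map; the associated quadratic form is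
  \<open>\<lambda>v. inner (hessian f x v) v\<close>.\<close>

definition hessian :: "('a::euclidean_space \<Rightarrow> real) \<Rightarrow> 'a \<Rightarrow> 'a \<Rightarrow> 'a" where
  "hessian f x = frechet_derivative (gradient f) (at x)"

definition C2_on :: "('a::euclidean_space \<Rightarrow> real) \<Rightarrow> 'a set \<Rightarrow> bool" where
  "C2_on f W \<longleftrightarrow>
     (\<forall>x\<in>W. f differentiable (at x)) \<and>
     (\<forall>x\<in>W. gradient f differentiable (at x)) \<and>
     (\<forall>v. continuous_on W (\<lambda>x. hessian f x v))"

definition local_defining_function ::
  "'a::euclidean_space set \<Rightarrow> 'a \<Rightarrow> 'a set \<Rightarrow> ('a \<Rightarrow> real) \<Rightarrow> bool" where
  "local_defining_function D \<xi> W \<rho> \<longleftrightarrow>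
     open W \<and> \<xi> \<in> W \<and> C2_on \<rho> W \<and>
     D \<inter> W = {x\<in>W. \<rho> x < 0} \<and>
     frontier D \<inter> W = {x\<in>W. \<rho> x = 0} \<and>
     (\<forall>x\<in>frontier D \<inter> W. gradient \<rho> x \<noteq> 0)"

definition C2_boundary_point :: "'a::euclidean_space set \<Rightarrow> 'a \<Rightarrow> bool" where
  "C2_boundary_point D \<xi> \<longleftrightarrow>
     \<xi> \<in> frontier D \<and> (\<exists>W \<rho>. local_defining_function D \<xi> W \<rho>)"

text \<open>Independence of the defining function is \<open>outer_normal_eq\<close> below.\<close>

definition outer_normal :: "'a::euclidean_space set \<Rightarrow> 'a \<Rightarrow> 'a" where
  "outer_normal D \<xi> =
     (THE n. \<exists>W \<rho>. local_defining_function D \<xi> W \<rho> \<and>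
                   n = gradient \<rho> \<xi> /\<^sub>R norm (gradient \<rho> \<xi>))"

definition tangent_space :: "'a::euclidean_space set \<Rightarrow> 'a \<Rightarrow> 'a set" where
  "tangent_space D \<xi> = {v. inner v (outer_normal D \<xi>) = 0}"

definition strongly_convex_boundary_point :: "'a::euclidean_space set \<Rightarrow> 'a \<Rightarrow> bool" where
  "strongly_convex_boundary_point D \<xi> \<longleftrightarrow>
     \<xi> \<in> frontier D \<and>
     (\<exists>W \<rho>. local_defining_function D \<xi> W \<rho> \<and>
            (\<forall>v\<in>tangent_space D \<xi>. v \<noteq> 0 \<longrightarrow> inner (hessian \<rho> \<xi> v) v > 0))"

lemma gradient_eqI:
  assumes "GDERIV f x :> g"
  shows "gradient f x = g"
  unfolding gradient_def
proof (rule the_equality)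
  fix g' assume "GDERIV f x :> g'"
  then have "(\<lambda>h. inner h g') = (\<lambda>h. inner h g)"
    using assms has_derivative_unique unfolding gderiv_def by blast
  then show "g' = g"
    by (metis vector_eq_rdot inner_commute)
qed (fact assms)

lemma gderiv_gradient:
  assumes "f differentiable (at x)"
  shows "GDERIV f x :> gradient f x"
proof -
  obtain f' where f': "(f has_derivative f') (at x)"
    using assms unfolding differentiable_def by blast
  then interpret bounded_linear f' by (rule has_derivative_bounded_linear)
  have "f' h = inner h (\<Sum>b\<in>Basis. f' b *\<^sub>R b)" for h
  proof -
    have "f' h = f' (\<Sum>b\<in>Basis. inner h b *\<^sub>R b)"
      by (simp add: euclidean_representation)
    also have "\<dots> = inner h (\<Sum>b\<in>Basis. f' b *\<^sub>R b)"
      by (simp add: sum scaleR inner_sum_right mult.commute)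
    finally show ?thesis .
  qed
  then have "f' = (\<lambda>h. inner h (\<Sum>b\<in>Basis. f' b *\<^sub>R b))" by blast
  then have "GDERIV f x :> (\<Sum>b\<in>Basis. f' b *\<^sub>R b)"
    using f' unfolding gderiv_def by metis
  then show ?thesis
    using gradient_eqI by metis
qed

lemma has_derivative_along_line:
  assumes "f differentiable (at x)"
  shows "((\<lambda>t. f (x + t *\<^sub>R v)) has_real_derivative inner v (gradient f x)) (at 0)"
proof -
  have 1: "((\<lambda>t. x + t *\<^sub>R v) has_derivative (\<lambda>t. t *\<^sub>R v)) (at (0::real))"
    by (auto intro!: derivative_eq_intros)
  have 2: "(f has_derivative (\<lambda>h. inner h (gradient f x))) (at (x + 0 *\<^sub>R v))"
    using gderiv_gradient[OF assms] by (simp add: gderiv_def)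
  show ?thesis
    using has_derivative_compose[OF 1 2]
    by (simp add: has_field_derivative_def mult_commute_abs)
qed

lemma outer_normal_eq:
  assumes \<xi>: "\<xi> \<in> frontier D" and \<rho>: "local_defining_function D \<xi> W \<rho>"
  shows "outer_normal D \<xi> = gradient \<rho> \<xi> /\<^sub>R norm (gradient \<rho> \<xi>)"
  unfolding outer_normal_def
proof (rule the_equality)
  show "\<exists>W' \<rho>'. local_defining_function D \<xi> W' \<rho>' \<and>
      gradient \<rho> \<xi> /\<^sub>R norm (gradient \<rho> \<xi>) = gradient \<rho>' \<xi> /\<^sub>R norm (gradient \<rho>' \<xi>)"
    using \<rho> by blast
next
  fix n assume "\<exists>W' \<rho>'. local_defining_function D \<xi> W' \<rho>' \<and>
      n = gradient \<rho>' \<xi> /\<^sub>R norm (gradient \<rho>' \<xi>)"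
  then obtain W' \<rho>' where \<rho>': "local_defining_function D \<xi> W' \<rho>'"
    and n: "n = gradient \<rho>' \<xi> /\<^sub>R norm (gradient \<rho>' \<xi>)" by blast
  define g g' where "g = gradient \<rho> \<xi>" and "g' = gradient \<rho>' \<xi>"
  define u u' where "u = g /\<^sub>R norm g" and "u' = g' /\<^sub>R norm g'"
  have g0: "g \<noteq> 0" "g' \<noteq> 0"
    using \<xi> \<rho> \<rho>' by (auto simp: local_defining_function_def g_def g'_def)
  have u: "norm u = 1" "norm u' = 1" "g = norm g *\<^sub>R u" "g' = norm g' *\<^sub>R u'"
    using g0 by (auto simp: u_def u'_def)
  have "u' = u"
  proof (rule ccontr)
    assume ne: "u' \<noteq> u"
    define v where "v = u' - u"
    have "0 < (norm v)\<^sup>2" using ne by (simp add: v_def)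
    also have "(norm v)\<^sup>2 = 2 - 2 * inner u u'"
      using u(1,2) by (simp add: v_def power2_norm_eq_inner inner_diff_left inner_diff_right
          inner_commute norm_eq_1)
    finally have lt: "inner u u' < 1" by simp
    have "inner v g = norm g * (inner u u' - 1)"
      by (subst u(3)) (use u(1) in \<open>simp add: v_def inner_diff_left inner_diff_right inner_commute norm_eq_1\<close>)
    then have neg: "inner v g < 0" using lt g0 by (simp add: mult_pos_neg)
    have "inner v g' = norm g' * (1 - inner u u')"
      by (subst u(4)) (use u(2) in \<open>simp add: v_def inner_diff_left inner_diff_right inner_commute norm_eq_1\<close>)
    then have pos: "inner v g' > 0" using lt g0 by simp
    have zero: "\<rho> \<xi> = 0" "\<rho>' \<xi> = 0"
      using \<xi> \<rho> \<rho>' unfolding local_defining_function_def by blast+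
    have diff: "\<rho> differentiable (at \<xi>)" "\<rho>' differentiable (at \<xi>)"
      using \<rho> \<rho>' by (auto simp: local_defining_function_def C2_on_def)
    obtain d where d: "d > 0" "\<And>h. 0 < h \<Longrightarrow> h < d \<Longrightarrow> \<rho> (\<xi> + h *\<^sub>R v) < 0"
      using DERIV_neg_dec_right[OF has_derivative_along_line[OF diff(1)], of v] neg zero
      by (auto simp: g_def)
    obtain d' where d': "d' > 0" "\<And>h. 0 < h \<Longrightarrow> h < d' \<Longrightarrow> \<rho>' (\<xi> + h *\<^sub>R v) > 0"
      using DERIV_pos_inc_right[OF has_derivative_along_line[OF diff(2)], of v] pos zero
      by (auto simp: g'_def)
    have "open (W \<inter> W')" "\<xi> \<in> W \<inter> W'"
      using \<rho> \<rho>' by (auto simp: local_defining_function_def)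
    then obtain e where e: "e > 0" "ball \<xi> e \<subseteq> W \<inter> W'"
      using open_contains_ball by blast
    have nv: "norm v > 0" using ne by (simp add: v_def)
    obtain h where h: "0 < h" "h < d" "h < d'" "h < e / norm v"
      using field_lbound_gt_zero[of "min d d'" "e / norm v"] d(1) d'(1) e(1) nv by auto
    then have "h * norm v < e" using nv by (simp add: field_simps)
    then have "\<xi> + h *\<^sub>R v \<in> W \<inter> W'"
      using e(2) h(1) by (auto simp: subset_eq dist_norm)
    moreover have "\<rho> (\<xi> + h *\<^sub>R v) < 0" "\<rho>' (\<xi> + h *\<^sub>R v) > 0"
      using d d' h by auto
    ultimately have "\<xi> + h *\<^sub>R v \<in> D" "\<xi> + h *\<^sub>R v \<in> W'" "\<not> \<rho>' (\<xi> + h *\<^sub>R v) < 0"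
      using \<rho> unfolding local_defining_function_def by auto
    then show False
      using \<rho>' unfolding local_defining_function_def by blast
  qed
  then show "n = gradient \<rho> \<xi> /\<^sub>R norm (gradient \<rho> \<xi>)"
    by (simp add: n u_def u'_def g_def g'_def)
qed

section \<open>Distance to the boundary and the normal/tangential splitting\<close>

definition boundary_dist :: "'a::euclidean_space set \<Rightarrow> 'a \<Rightarrow> real" where
  "boundary_dist D x = infdist x (frontier D)"

text \<open>\<open>closest_point\<close> is a choice function, so \<open>normal_part\<close> and \<open>tangential_part\<close> are only
  meaningful where the nearest boundary point is unique and smooth.\<close>

definition has_unique_C2_projection :: "'a::euclidean_space set \<Rightarrow> 'a \<Rightarrow> bool" where
  "has_unique_C2_projection D x \<longleftrightarrow>
     (\<exists>!p. p \<in> frontier D \<and> dist x p = infdist x (frontier D)) \<and>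
     C2_boundary_point D (closest_point (frontier D) x)"

definition normal_part :: "'a::euclidean_space set \<Rightarrow> 'a \<Rightarrow> 'a \<Rightarrow> 'a" where
  "normal_part D x v =
     (let n = outer_normal D (closest_point (frontier D) x) in inner v n *\<^sub>R n)"

definition tangential_part :: "'a::euclidean_space set \<Rightarrow> 'a \<Rightarrow> 'a \<Rightarrow> 'a" where
  "tangential_part D x v = v - normal_part D x v"

section \<open>The Kobayashi--Hilbert metric\<close>

definition projective_map :: "(real \<Rightarrow> 'a::euclidean_space) \<Rightarrow> bool" where
  "projective_map f \<longleftrightarrow>
     (\<exists>a b c. \<forall>t\<in>{-1<..<1}. 1 + c * t \<noteq> 0 \<and> f t = (a + t *\<^sub>R b) /\<^sub>R (1 + c * t))"

text \<open>The value \<open>r = 0\<close> would contribute \<open>1 / 0 = \<infinity>\<close> to the infimum; it is excluded because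
  \<open>1 / 0 = 0\<close> for the type \<open>real\<close>.\<close>

definition kobayashi_hilbert :: "'a::euclidean_space set \<Rightarrow> 'a \<Rightarrow> 'a \<Rightarrow> real" where
  "kobayashi_hilbert D x v =
     Inf {1 / \<bar>r\<bar> | r f. r \<noteq> 0 \<and> projective_map f \<and> f ` {-1<..<1} \<subseteq> D \<and>
                       f 0 = x \<and> (f has_vector_derivative r *\<^sub>R v) (at 0)}"

end

theory Submission
  imports Defs
begin

text \<open>
  Let \<open>p\<close> be the boundary point nearest to \<open>x\<close>, \<open>n\<close> the outer normal there and
  \<open>\<delta> = dist x p\<close>, so that \<open>x = p - \<delta> *\<^sub>R n\<close>.  Strong convexity at \<open>\<xi>\<close> persists nearby with a
  uniform constant: for boundary points \<open>p\<close> close to \<open>\<xi>\<close>, the part of \<open>D\<close> close to \<open>\<xi>\<close>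
  lies in the ball of radius \<open>1 / (2 * \<kappa>)\<close> that is tangent to the boundary at \<open>p\<close>
  (\<open>uniformly_supporting_balls\<close>).  For a ball the Hilbert metric is explicit, since the endpoints
  of a chord are the roots of a quadratic equation, and it satisfies the estimate even without the
  error term in the normal direction (\<open>ball_metric_estimate\<close>).

  The metric only sees the segment of \<open>D\<close> through \<open>x\<close> in direction \<open>v\<close>: a projective map on
  \<open>(-1, 1)\<close> is \<open>x + (t / (1 + c * t)) *\<^sub>R (r *\<^sub>R v)\<close> with \<open>\<bar>c\<bar> \<le> 1\<close>
  (\<open>projective_map_line\<close>).  But \<open>D\<close> is inside the ball only locally, and the segment may
  run far away from \<open>p\<close>.  It can do so only on the side pointing away from the boundary and only
  if \<open>v\<close> makes a definite angle with the tangent plane.  In that case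
  \<open>norm v\<^sub>T \<le> C * norm v\<^sub>N\<close>, so that \<open>(norm v\<^sub>T)\<^sup>2 / \<delta>\<close> is of the size of the error term
  \<open>\<delta> * (norm v\<^sub>N)\<^sup>2 / \<delta>\<^sup>2\<close>, and the supporting hyperplane at \<open>p\<close> alone gives the bound
  (\<open>segment_estimate\<close>).

  Nearest points are unique because a ball touching the boundary at \<open>p\<close> from one side has its
  centre on the normal line at \<open>p\<close>, and the unit normals depend on \<open>p\<close> in a Lipschitz way
  (\<open>unique_projection_near_C2_point\<close>).
\<close>

section \<open>Second-order behaviour of a defining function\<close>

lemma C2_gradient_has_derivative:
  assumes "C2_on f W" "x \<in> W"
  shows "(gradient f has_derivative hessian f x) (at x)"
  using assms unfolding C2_on_def hessian_def
  by (metis frechet_derivative_works)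

lemma C2_gradient_continuous:
  assumes "C2_on f W" "x \<in> W"
  shows "continuous (at x) (gradient f)"
  using C2_gradient_has_derivative[OF assms] has_derivative_continuous by blast

text \<open>Continuity of \<open>\<lambda>x. hessian f x v\<close> for each fixed \<open>v\<close> is continuity in the operator
  norm, because the finitely many basis vectors control all directions at once.\<close>

lemma C2_hessian_near:
  fixes f :: "'a::euclidean_space \<Rightarrow> real"
  assumes C2: "C2_on f W" and W: "open W" "\<xi> \<in> W" and e: "e > 0"
  obtains d where "d > 0" "ball \<xi> d \<subseteq> W"
    "\<And>z h. z \<in> ball \<xi> d \<Longrightarrow> norm (hessian f z h - hessian f \<xi> h) \<le> e * norm h"
proof -
  define F where "F z = (\<Sum>b\<in>Basis. norm (hessian f z b - hessian f \<xi> b))" for z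
  have "continuous_on W F"
    using C2 unfolding F_def C2_on_def by (intro continuous_intros) auto
  then have "isCont F \<xi>"
    using W by (simp add: continuous_on_eq_continuous_at)
  moreover have "F \<xi> = 0" by (simp add: F_def)
  ultimately have "\<forall>\<^sub>F z in at \<xi>. F z < e"
    using e by (metis isCont_def order_tendstoD(2))
  then obtain d1 where d1: "d1 > 0" "\<And>z. z \<noteq> \<xi> \<Longrightarrow> dist z \<xi> < d1 \<Longrightarrow> F z < e"
    unfolding eventually_at by auto
  obtain d2 where d2: "d2 > 0" "ball \<xi> d2 \<subseteq> W"
    using W open_contains_ball by blast
  show thesis
  proof
    show "min d1 d2 > 0" using d1 d2 by simp
    show "ball \<xi> (min d1 d2) \<subseteq> W" using d2 by auto
    fix z h assume z: "z \<in> ball \<xi> (min d1 d2)"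
    have "z \<in> W" using z d2 by auto
    have Fz: "F z \<le> e"
      using d1(2)[of z] z e \<open>F \<xi> = 0\<close> by (cases "z = \<xi>") (auto simp: dist_commute)
    have bl: "bounded_linear (\<lambda>h. hessian f z h - hessian f \<xi> h)"
      using C2_gradient_has_derivative[OF C2] \<open>z \<in> W\<close> W
      by (intro bounded_linear_sub) (auto intro: has_derivative_bounded_linear)
    define A where "A = (\<lambda>h. hessian f z h - hessian f \<xi> h)"
    interpret A: bounded_linear A using bl by (simp add: A_def)
    have "A h = A (\<Sum>b\<in>Basis. inner h b *\<^sub>R b)"
      by (simp add: euclidean_representation)
    also have "\<dots> = (\<Sum>b\<in>Basis. inner h b *\<^sub>R A b)"
      by (simp add: A.sum A.scaleR)
    also have "norm \<dots> \<le> (\<Sum>b\<in>Basis. norm h * norm (A b))"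
      by (intro sum_norm_le) (auto intro!: mult_right_mono Basis_le_norm)
    also have "\<dots> = norm h * F z"
      by (simp add: A_def F_def sum_distrib_left)
    also have "\<dots> \<le> e * norm h"
      using Fz by (metis mult.commute mult_left_mono norm_ge_zero)
    finally show "norm (hessian f z h - hessian f \<xi> h) \<le> e * norm h"
      by (simp add: A_def)
  qed
qed

text \<open>Finsler's lemma: on the compact part of the unit sphere where the form is nonpositive,
  \<open>inner g h\<close> does not vanish, so a large multiple of its square outweighs the form there.\<close>

lemma definite_on_hyperplane_penalised:
  fixes A :: "'a::euclidean_space \<Rightarrow> 'a"
  assumes A: "bounded_linear A"
    and pos: "\<And>h. h \<noteq> 0 \<Longrightarrow> inner g h = 0 \<Longrightarrow> inner (A h) h > 0"
  obtains K \<mu> where "K > 0" "\<mu> > 0"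
    "\<And>h. \<mu> * (norm h)\<^sup>2 \<le> inner (A h) h + K * (inner g h)\<^sup>2"
proof -
  interpret A: bounded_linear A by (fact A)
  define S where "S = {h. norm h = (1::real)} \<inter> {h. inner (A h) h \<le> 0}"
  have contA: "continuous_on T A" for T
    using A by (rule linear_continuous_on)
  have cont: "continuous_on T (\<lambda>h. inner (A h) h)"
    "continuous_on T (\<lambda>h. (inner g h)\<^sup>2)"
    "continuous_on T (\<lambda>h. inner (A h) h + K * (inner g h)\<^sup>2)" for T K
    by (intro continuous_intros contA)+
  have cS: "compact (sphere (0::'a) 1)" by simp
  have Sne: "sphere (0::'a) 1 \<noteq> {}" by simp
  have "closed {h. inner (A h) h \<le> 0}"
    by (intro closed_Collect_le continuous_intros contA)
  then have compS: "compact S"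
    using cS compact_Int_closed unfolding S_def sphere_def by auto
  have "\<exists>K>0. \<forall>h\<in>sphere 0 1. inner (A h) h + K * (inner g h)\<^sup>2 > 0"
  proof (cases "S = {}")
    case True
    then have "\<forall>h\<in>sphere 0 1. inner (A h) h + 1 * (inner g h)\<^sup>2 > 0"
      by (auto simp: S_def intro!: add_pos_nonneg)
    then show ?thesis using zero_less_one by blast
  next
    case False
    obtain h0 where h0: "h0 \<in> S" "\<And>h. h \<in> S \<Longrightarrow> (inner g h0)\<^sup>2 \<le> (inner g h)\<^sup>2"
      using continuous_attains_inf[OF compS False, of "\<lambda>h. (inner g h)\<^sup>2"]
      by (metis (no_types, lifting) cont)
    obtain h1 where h1: "h1 \<in> S" "\<And>h. h \<in> S \<Longrightarrow> inner (A h1) h1 \<le> inner (A h) h"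
      using continuous_attains_inf[OF compS False, of "\<lambda>h. inner (A h) h"]
      by (metis (no_types, lifting) cont)
    define m M where "m = (inner g h0)\<^sup>2" and "M = - inner (A h1) h1"
    have m: "m > 0"
      using pos[of h0] h0(1) by (cases "h0 = 0") (auto simp: m_def S_def)
    have M: "M \<ge> 0" using h1(1) by (simp add: M_def S_def)
    define K where "K = (M + 1) / m"
    have K: "K > 0" using m M by (simp add: K_def)
    have "inner (A h) h + K * (inner g h)\<^sup>2 > 0" if "h \<in> sphere 0 1" for h
    proof (cases "h \<in> S")
      case True
      have "K * (inner g h)\<^sup>2 \<ge> K * m"
        using h0(2)[OF True] K by (simp add: m_def)
      moreover have "K * m = M + 1" using m by (simp add: K_def)
      ultimately show ?thesis using h1(2)[OF True] by (simp add: M_def)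
    next
      case False
      then have "inner (A h) h > 0" using that by (auto simp: S_def)
      then show ?thesis using K by (simp add: add_pos_nonneg)
    qed
    then show ?thesis using K by blast
  qed
  then obtain K where K: "K > 0"
    and Kpos: "\<And>h. h \<in> sphere 0 1 \<Longrightarrow> inner (A h) h + K * (inner g h)\<^sup>2 > 0" by blast
  obtain h2 where h2: "h2 \<in> sphere 0 1"
    "\<And>h. h \<in> sphere 0 1 \<Longrightarrow>
      inner (A h2) h2 + K * (inner g h2)\<^sup>2 \<le> inner (A h) h + K * (inner g h)\<^sup>2"
    using continuous_attains_inf[OF cS Sne, of "\<lambda>h. inner (A h) h + K * (inner g h)\<^sup>2"]
    by (metis (no_types, lifting) cont)
  define \<mu> where "\<mu> = inner (A h2) h2 + K * (inner g h2)\<^sup>2"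
  show thesis
  proof
    show "K > 0" by (fact K)
    show "\<mu> > 0" using Kpos[OF h2(1)] by (simp add: \<mu>_def)
    fix h
    show "\<mu> * (norm h)\<^sup>2 \<le> inner (A h) h + K * (inner g h)\<^sup>2"
    proof (cases "h = 0")
      case True then show ?thesis by (simp add: A.zero)
    next
      case False
      define u where "u = h /\<^sub>R norm h"
      have u: "u \<in> sphere 0 1" "h = norm h *\<^sub>R u" using False by (auto simp: u_def)
      have "\<mu> * (norm h)\<^sup>2 \<le> (inner (A u) u + K * (inner g u)\<^sup>2) * (norm h)\<^sup>2"
        using h2(2)[OF u(1)] by (simp add: \<mu>_def mult_right_mono)
      also have "\<dots> = inner (A (norm h *\<^sub>R u)) (norm h *\<^sub>R u) + K * (inner g (norm h *\<^sub>R u))\<^sup>2"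
        by (simp add: A.scaleR power2_eq_square algebra_simps)
      finally show ?thesis by (simp flip: u(2))
    qed
  qed
qed

lemma C2_Taylor_segment:
  fixes f :: "'a::euclidean_space \<Rightarrow> real"
  assumes C2: "C2_on f W" and seg: "closed_segment p y \<subseteq> W"
  obtains z where "z \<in> closed_segment p y"
    "f y = f p + inner (gradient f p) (y - p) + inner (hessian f z (y - p)) (y - p) / 2"
proof -
  define h where "h = y - p"
  define diff :: "nat \<Rightarrow> real \<Rightarrow> real" where "diff = (\<lambda>k t.
    if k = 0 then f (p + t *\<^sub>R h)
    else if k = 1 then inner (gradient f (p + t *\<^sub>R h)) h
    else inner (hessian f (p + t *\<^sub>R h) h) h)"
  have inW: "p + t *\<^sub>R h \<in> closed_segment p y" if "0 \<le> t" "t \<le> 1" for t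
    using that by (auto simp: closed_segment_def h_def algebra_simps intro!: exI[of _ t])
  have line: "((\<lambda>t. p + t *\<^sub>R h) has_derivative (\<lambda>s. s *\<^sub>R h)) (at t)" for t
    by (auto intro!: derivative_eq_intros)
  have "DERIV (diff m) t :> diff (Suc m) t" if m: "m < 2" and t: "0 \<le> t" "t \<le> 1" for m t
  proof -
    have z: "p + t *\<^sub>R h \<in> W" using inW seg t by blast
    consider "m = 0" | "m = 1" using m by linarith
    then show ?thesis
    proof cases
      case 1
      have "(f has_derivative (\<lambda>s. inner s (gradient f (p + t *\<^sub>R h)))) (at (p + t *\<^sub>R h))"
        using C2 z gderiv_gradient unfolding C2_on_def gderiv_def by blast
      from has_derivative_compose[OF line this] show ?thesis
        by (simp add: 1 diff_def has_field_derivative_def inner_commute mult_commute_abs)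
    next
      case 2
      interpret H: bounded_linear "hessian f (p + t *\<^sub>R h)"
        using C2_gradient_has_derivative[OF C2 z] by (rule has_derivative_bounded_linear)
      have "((\<lambda>t. inner (gradient f (p + t *\<^sub>R h)) h) has_derivative
          (\<lambda>s. inner (hessian f (p + t *\<^sub>R h) (s *\<^sub>R h)) h)) (at t)"
        by (intro has_derivative_inner_left
              has_derivative_compose[OF line C2_gradient_has_derivative[OF C2 z]])
      then show ?thesis
        by (simp add: 2 diff_def has_field_derivative_def H.scaleR mult_commute_abs)
    qed
  qed
  then obtain t where t: "0 < t" "t < 1"
    "diff 0 1 = (\<Sum>m<2. diff m 0 / fact m * (1 - 0) ^ m) + diff 2 t / fact 2 * (1 - 0) ^ 2"
    using Taylor_up[of 2 diff "diff 0" 0 1 0] by auto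
  show thesis
  proof
    show "p + t *\<^sub>R h \<in> closed_segment p y" using inW t by simp
    show "f y = f p + inner (gradient f p) (y - p) +
        inner (hessian f (p + t *\<^sub>R h) (y - p)) (y - p) / 2"
      using t(3) by (simp add: diff_def numeral_2_eq_2 h_def)
  qed
qed

section \<open>Local geometry of a strongly convex boundary\<close>

lemma local_defining_function_moved:
  assumes "local_defining_function D \<xi> W \<rho>" "p \<in> W"
  shows "local_defining_function D p W \<rho>"
  using assms by (simp add: local_defining_function_def)

lemma unit_vectors_dist:
  fixes a b :: "'a::real_normed_vector"
  assumes "a \<noteq> 0" "b \<noteq> 0"
  shows "norm (a /\<^sub>R norm a - b /\<^sub>R norm b) \<le> 2 * norm (a - b) / norm a"
proof -
  have "(norm b - norm a) / (norm a * norm b) = inverse (norm a) - inverse (norm b)"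
    using assms by (simp add: field_simps)
  then have "a /\<^sub>R norm a - b /\<^sub>R norm b =
      (a - b) /\<^sub>R norm a + ((norm b - norm a) / (norm a * norm b)) *\<^sub>R b"
    by (simp add: scaleR_left_diff_distrib scaleR_right_diff_distrib)
  also have "norm \<dots> \<le> norm (a - b) / norm a + \<bar>norm b - norm a\<bar> / norm a"
  proof (rule norm_triangle_le)
    have "norm ((a - b) /\<^sub>R norm a) = norm (a - b) / norm a"
      by (simp add: divide_inverse_commute)
    moreover have "norm (((norm b - norm a) / (norm a * norm b)) *\<^sub>R b) =
        \<bar>norm b - norm a\<bar> / norm a"
      using assms by (simp add: abs_mult)
    ultimately show "norm ((a - b) /\<^sub>R norm a) +
        norm (((norm b - norm a) / (norm a * norm b)) *\<^sub>R b)
        \<le> norm (a - b) / norm a + \<bar>norm b - norm a\<bar> / norm a" by simp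
  qed
  also have "\<dots> \<le> norm (a - b) / norm a + norm (a - b) / norm a"
    by (intro add_left_mono divide_right_mono)
       (auto simp: norm_triangle_ineq3 norm_minus_commute[of a b])
  finally show ?thesis by simp
qed

text \<open>The Hessian is bounded near \<open>\<xi>\<close> and the gradient stays away from \<open>0\<close>, so the unit normal
  is Lipschitz along the boundary.  This is what makes nearest points unique.\<close>

lemma outer_normal_Lipschitz:
  fixes D :: "'a::euclidean_space set"
  assumes \<rho>: "local_defining_function D \<xi> W \<rho>" and \<xi>: "\<xi> \<in> frontier D"
  obtains L e where "L > 0" "e > 0"
    "\<And>p q. p \<in> frontier D \<inter> ball \<xi> e \<Longrightarrow> q \<in> frontier D \<inter> ball \<xi> e \<Longrightarrow>
       norm (outer_normal D p - outer_normal D q) \<le> L * dist p q"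
proof -
  define g where "g = gradient \<rho>"
  have W: "open W" "\<xi> \<in> W" and C2: "C2_on \<rho> W"
    and g0: "\<And>p. p \<in> frontier D \<inter> W \<Longrightarrow> g p \<noteq> 0"
    using \<rho> by (auto simp: local_defining_function_def g_def)
  have gder: "(g has_derivative hessian \<rho> z) (at z)" if "z \<in> W" for z
    using C2_gradient_has_derivative[OF C2 that] by (simp add: g_def)
  interpret H: bounded_linear "hessian \<rho> \<xi>"
    using gder[OF W(2)] by (rule has_derivative_bounded_linear)
  obtain d where d: "d > 0" "ball \<xi> d \<subseteq> W"
    "\<And>z h. z \<in> ball \<xi> d \<Longrightarrow> norm (hessian \<rho> z h - hessian \<rho> \<xi> h) \<le> 1 * norm h"
    using C2_hessian_near[OF C2 W zero_less_one] by blast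
  define B where "B = 1 + onorm (hessian \<rho> \<xi>)"
  have B: "B > 0" using H.bounded_linear_axioms by (simp add: B_def onorm_pos_le add_pos_nonneg)
  have hess: "norm (hessian \<rho> z h) \<le> B * norm h" if "z \<in> ball \<xi> d" for z h
    using d(3)[OF that, of h] onorm[OF H.bounded_linear_axioms, of h]
      norm_triangle_sub[of "hessian \<rho> z h" "hessian \<rho> \<xi> h"]
    by (simp add: B_def algebra_simps)
  have gLip: "norm (g p - g q) \<le> B * norm (p - q)" if "p \<in> ball \<xi> d" "q \<in> ball \<xi> d" for p q
  proof (rule differentiable_bound[OF convex_ball])
    fix z assume z: "z \<in> ball \<xi> d"
    show "(g has_derivative hessian \<rho> z) (at z within ball \<xi> d)"
      using gder z d(2) has_derivative_at_withinI by blast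
    show "onorm (hessian \<rho> z) \<le> B"
      using hess[OF z] by (intro onorm_le) auto
  qed (use that in auto)
  have "norm (g \<xi>) > 0" using g0 \<xi> W by auto
  define e where "e = min d (norm (g \<xi>) / (2 * B))"
  show thesis
  proof
    show "4 * B / norm (g \<xi>) > 0" using B \<open>norm (g \<xi>) > 0\<close> by simp
    show "e > 0" using d B \<open>norm (g \<xi>) > 0\<close> by (simp add: e_def)
    fix p q assume p: "p \<in> frontier D \<inter> ball \<xi> e" and q: "q \<in> frontier D \<inter> ball \<xi> e"
    have pq: "p \<in> ball \<xi> d" "q \<in> ball \<xi> d" using p q by (auto simp: e_def)
    then have pqW: "p \<in> W" "q \<in> W" using d by auto
    have n: "outer_normal D p = g p /\<^sub>R norm (g p)" "outer_normal D q = g q /\<^sub>R norm (g q)"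
      using outer_normal_eq local_defining_function_moved[OF \<rho>] p q pqW
      by (metis IntD1 g_def)+
    have "norm (g \<xi> - g p) \<le> B * norm (\<xi> - p)" using gLip pq d by simp
    also have "\<dots> \<le> B * (norm (g \<xi>) / (2 * B))"
      using p B by (intro mult_left_mono) (auto simp: e_def dist_norm)
    finally have "norm (g \<xi> - g p) \<le> norm (g \<xi>) / 2" using B by simp
    then have gp: "norm (g p) \<ge> norm (g \<xi>) / 2"
      using norm_triangle_sub[of "g \<xi>" "g p"] by simp
    have "norm (outer_normal D p - outer_normal D q) \<le> 2 * norm (g p - g q) / norm (g p)"
      unfolding n using g0 p q pqW by (intro unit_vectors_dist) auto
    also have "\<dots> \<le> 2 * (B * norm (p - q)) / (norm (g \<xi>) / 2)"
      using gp gLip[OF pq] B \<open>norm (g \<xi>) > 0\<close> by (intro frac_le) auto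
    also have "\<dots> = 4 * B / norm (g \<xi>) * dist p q" by (simp add: dist_norm)
    finally show "norm (outer_normal D p - outer_normal D q) \<le> 4 * B / norm (g \<xi>) * dist p q" .
  qed
qed

text \<open>By the penalised definiteness of the Hessian, Taylor's formula at \<open>p\<close> forces
  \<open>inner (gradient \<rho> p) (y - p)\<close> to be quadratically negative wherever \<open>\<rho> y < 0\<close>; the penalty,
  being of second order in this very quantity, is absorbed close to \<open>\<xi>\<close>.  Equivalently, near \<open>\<xi>\<close>
  the domain lies in the ball of radius \<open>1 / (2 * \<kappa>)\<close> tangent to its boundary at \<open>p\<close>.\<close>

lemma uniformly_supporting_balls:
  fixes D :: "'a::euclidean_space set"
  assumes \<rho>: "local_defining_function D \<xi> W \<rho>" and \<xi>: "\<xi> \<in> frontier D"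
    and pos: "\<forall>v\<in>tangent_space D \<xi>. v \<noteq> 0 \<longrightarrow> inner (hessian \<rho> \<xi> v) v > 0"
  obtains \<kappa> e where "\<kappa> > 0" "e > 0"
    "\<And>p y. p \<in> frontier D \<inter> ball \<xi> e \<Longrightarrow> y \<in> D \<inter> ball \<xi> e \<Longrightarrow>
       inner (y - p) (outer_normal D p) \<le> - \<kappa> * (norm (y - p))\<^sup>2"
proof -
  define g where "g = gradient \<rho>"
  have W: "open W" "\<xi> \<in> W" and C2: "C2_on \<rho> W"
    and g0: "\<And>p. p \<in> frontier D \<inter> W \<Longrightarrow> g p \<noteq> 0"
    and neg: "\<And>y. y \<in> D \<Longrightarrow> y \<in> W \<Longrightarrow> \<rho> y < 0"
    and zero: "\<And>y. y \<in> frontier D \<Longrightarrow> y \<in> W \<Longrightarrow> \<rho> y = 0"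
    using \<rho> unfolding local_defining_function_def g_def by blast+
  define G where "G = norm (g \<xi>)"
  have G: "G > 0" using g0 \<xi> W by (simp add: G_def)
  have bl: "bounded_linear (hessian \<rho> \<xi>)"
    using C2_gradient_has_derivative[OF C2 W(2)] by (rule has_derivative_bounded_linear)
  have "inner (hessian \<rho> \<xi> h) h > 0" if "h \<noteq> 0" "inner (g \<xi>) h = 0" for h
    using pos that outer_normal_eq[OF \<xi> \<rho>]
    by (simp add: tangent_space_def g_def inner_commute)
  then obtain K \<mu> where K: "K > 0" and \<mu>: "\<mu> > 0"
    and fins: "\<And>h. \<mu> * (norm h)\<^sup>2 \<le> inner (hessian \<rho> \<xi> h) h + K * (inner (g \<xi>) h)\<^sup>2"
    using definite_on_hyperplane_penalised[OF bl, of "g \<xi>"] by blast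
  obtain d where d: "d > 0" "ball \<xi> d \<subseteq> W"
    "\<And>z h. z \<in> ball \<xi> d \<Longrightarrow> norm (hessian \<rho> z h - hessian \<rho> \<xi> h) \<le> \<mu> / 4 * norm h"
    using C2_hessian_near[OF C2 W, of "\<mu> / 4"] \<mu> by auto
  define \<eta> where "\<eta> = min G (\<mu> / (12 * K * G))"
  have \<eta>: "\<eta> > 0" using G \<mu> K by (simp add: \<eta>_def)
  obtain d' where d': "d' > 0" "\<And>p. dist p \<xi> < d' \<Longrightarrow> dist (g p) (g \<xi>) < \<eta>"
    using C2_gradient_continuous[OF C2 W(2)] \<eta> unfolding continuous_at_eps_delta g_def by blast
  define e where "e = min (min d d') (1 / (4 * K * G))"
  have e: "e > 0" "e \<le> d" "e \<le> d'" "e \<le> 1 / (4 * K * G)"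
    using d d' K G by (auto simp: e_def)
  show thesis
  proof
    show "\<mu> / (12 * G) > 0" using \<mu> G by simp
    show "e > 0" by (fact e)
    fix p y assume p: "p \<in> frontier D \<inter> ball \<xi> e" and y: "y \<in> D \<inter> ball \<xi> e"
    define h where "h = y - p"
    define \<tau> where "\<tau> = inner (g p) h"
    have pd: "p \<in> ball \<xi> d" "y \<in> ball \<xi> d" "dist p \<xi> < d'" using p y e by (auto simp: dist_commute)
    have pW: "p \<in> W" "y \<in> W" using pd d by auto
    have dg: "norm (g p - g \<xi>) < \<eta>" using d'(2)[OF pd(3)] by (simp add: dist_norm)
    have gp: "norm (g p) \<le> 2 * G"
      using dg norm_triangle_sub[of "g p" "g \<xi>"] by (simp add: \<eta>_def G_def)
    have gp0: "norm (g p) > 0" using g0 p pW by auto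
    have seg: "closed_segment p y \<subseteq> ball \<xi> d"
      using pd by (intro closed_segment_subset) auto
    obtain z where z: "z \<in> closed_segment p y"
      "\<rho> y = \<rho> p + inner (g p) h + inner (hessian \<rho> z h) h / 2"
      using C2_Taylor_segment[OF C2, of p y] seg d unfolding g_def h_def by blast
    have "z \<in> ball \<xi> d" using z seg by blast
    have "\<bar>inner (hessian \<rho> z h - hessian \<rho> \<xi> h) h\<bar> \<le> \<mu> / 4 * norm h * norm h"
      using d(3)[OF \<open>z \<in> ball \<xi> d\<close>, of h]
      by (intro order_trans[OF Cauchy_Schwarz_ineq2] mult_right_mono) auto
    then have 1: "inner (hessian \<rho> z h) h \<ge> inner (hessian \<rho> \<xi> h) h - \<mu> / 4 * (norm h)\<^sup>2"
      by (simp only: inner_diff_left power2_eq_square abs_le_iff mult.assoc) linarith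
    have "(inner (g \<xi>) h)\<^sup>2 - \<tau>\<^sup>2 = inner (g \<xi> - g p) h * inner (g \<xi> + g p) h"
      by (simp add: \<tau>_def inner_diff_left inner_add_left power2_eq_square algebra_simps)
    also have "\<dots> \<le> \<bar>inner (g \<xi> - g p) h\<bar> * \<bar>inner (g \<xi> + g p) h\<bar>"
      by (metis abs_ge_self abs_mult)
    also have "\<dots> \<le> (\<eta> * norm h) * (3 * G * norm h)"
    proof (intro mult_mono)
      show "\<bar>inner (g \<xi> - g p) h\<bar> \<le> \<eta> * norm h"
        using dg by (intro order_trans[OF Cauchy_Schwarz_ineq2] mult_right_mono)
                    (auto simp: norm_minus_commute)
      have "norm (g \<xi> + g p) \<le> 3 * G"
        using norm_triangle_ineq[of "g \<xi>" "g p"] gp by (simp add: G_def)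
      then show "\<bar>inner (g \<xi> + g p) h\<bar> \<le> 3 * G * norm h"
        by (intro order_trans[OF Cauchy_Schwarz_ineq2] mult_right_mono) auto
    qed (use \<eta> in auto)
    finally have "K * ((inner (g \<xi>) h)\<^sup>2 - \<tau>\<^sup>2) \<le> K * ((\<eta> * norm h) * (3 * G * norm h))"
      using K by simp
    then have "K * (inner (g \<xi>) h)\<^sup>2 - K * \<tau>\<^sup>2 \<le> (3 * K * G * \<eta>) * (norm h)\<^sup>2"
      by (simp add: power2_eq_square algebra_simps)
    moreover have "3 * K * G * \<eta> \<le> 3 * K * G * (\<mu> / (12 * K * G))"
      using K G by (intro mult_left_mono) (auto simp: \<eta>_def)
    then have "3 * K * G * \<eta> \<le> \<mu> / 4" using K G by simp
    then have "(3 * K * G * \<eta>) * (norm h)\<^sup>2 \<le> \<mu> / 4 * (norm h)\<^sup>2"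
      by (rule mult_right_mono) simp
    ultimately have 2: "K * (inner (g \<xi>) h)\<^sup>2 \<le> K * \<tau>\<^sup>2 + \<mu> / 4 * (norm h)\<^sup>2"
      by linarith
    \<comment> \<open>The penalty is quadratic in \<open>\<tau>\<close>, hence at most \<open>\<bar>\<tau>\<bar> / 2\<close> for small \<open>h\<close>.\<close>
    have 3: "\<tau> \<le> K * \<tau>\<^sup>2 / 2 - \<mu> / 4 * (norm h)\<^sup>2"
    proof -
      have "\<rho> y < 0" "\<rho> p = 0" using neg zero p y pW by auto
      then have "\<tau> \<le> - (inner (hessian \<rho> z h) h / 2)" using z(2) by (simp add: \<tau>_def)
      then show ?thesis using 1 2 fins[of h] by (simp add: field_split_simps)
    qed
    have "norm h \<le> 2 * e"
      using p y dist_triangle3[of y p \<xi>] by (simp add: h_def dist_norm)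
    then have nh: "norm h \<le> 2 * (1 / (4 * K * G))" using e(4) by linarith
    have "\<bar>\<tau>\<bar> \<le> norm (g p) * norm h" unfolding \<tau>_def by (rule Cauchy_Schwarz_ineq2)
    also have "\<dots> \<le> (2 * G) * (2 * (1 / (4 * K * G)))"
      by (rule mult_mono[OF gp nh]) (use G in auto)
    also have "\<dots> = 1 / K" using G by simp
    finally have "K * \<bar>\<tau>\<bar> \<le> 1" using K by (simp add: field_simps)
    then have "K * \<bar>\<tau>\<bar> * \<bar>\<tau>\<bar> \<le> \<bar>\<tau>\<bar>" using mult_right_mono[of "K * \<bar>\<tau>\<bar>" 1 "\<bar>\<tau>\<bar>"] by simp
    then have "K * \<tau>\<^sup>2 \<le> \<bar>\<tau>\<bar>" by (simp add: power2_eq_square mult.assoc)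
    moreover have "\<mu> * (norm h)\<^sup>2 \<ge> 0" using \<mu> by simp
    ultimately have \<tau>: "\<tau> \<le> - \<mu> / 6 * (norm h)\<^sup>2"
      using 3 by (cases "\<tau> \<ge> 0") auto
    have n: "outer_normal D p = g p /\<^sub>R norm (g p)"
      using outer_normal_eq local_defining_function_moved[OF \<rho>] p pW by (metis IntD1 g_def)
    have "inner h (outer_normal D p) = \<tau> / norm (g p)"
      by (simp add: n \<tau>_def inner_commute divide_inverse mult.commute)
    also have "\<dots> \<le> - (\<mu> / 6 * (norm h)\<^sup>2) / norm (g p)"
      using \<tau> gp0 by (intro divide_right_mono) auto
    also have "\<dots> \<le> - ((\<mu> / 6 * (norm h)\<^sup>2) / (2 * G))"
      using gp gp0 \<mu> by (simp add: frac_le)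
    finally show "inner (y - p) (outer_normal D p) \<le> - (\<mu> / (12 * G)) * (norm (y - p))\<^sup>2"
      by (simp add: h_def)
  qed
qed

section \<open>Nearest boundary points\<close>

text \<open>A vector with positive normal component leads out of \<open>D\<close>, and its negative into \<open>D\<close>,
  because the defining function has nonzero derivative along it at \<open>p\<close>.\<close>

lemma outward_direction_leaves:
  assumes p: "p \<in> frontier D" and \<rho>: "local_defining_function D p W \<rho>"
    and h: "inner h (outer_normal D p) > 0"
  shows "\<forall>\<^sub>F t in at_right 0. p + t *\<^sub>R h \<notin> D"
    and "\<forall>\<^sub>F t in at_right 0. p + t *\<^sub>R (- h) \<in> D"
proof -
  have W: "open W" "p \<in> W" and g0: "gradient \<rho> p \<noteq> 0" and \<rho>p: "\<rho> p = 0"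
    and diff: "\<rho> differentiable (at p)" and D: "\<And>y. y \<in> W \<Longrightarrow> y \<in> D \<longleftrightarrow> \<rho> y < 0"
    using \<rho> p unfolding local_defining_function_def C2_on_def by blast+
  have pos: "inner h (gradient \<rho> p) > 0"
    using h g0 by (simp add: outer_normal_eq[OF p \<rho>] zero_less_mult_iff)
  have inW: "\<forall>\<^sub>F t in at_right 0. p + t *\<^sub>R k \<in> W" for k
  proof (rule topological_tendstoD)
    show "((\<lambda>t. p + t *\<^sub>R k) \<longlongrightarrow> p) (at_right 0)"
      by (auto intro!: tendsto_eq_intros)
  qed (use W in auto)
  obtain d where "d > 0" "\<And>t. 0 < t \<Longrightarrow> t < d \<Longrightarrow> 0 < \<rho> (p + t *\<^sub>R h)"
    using DERIV_pos_inc_right[OF has_derivative_along_line[OF diff, of h] pos] \<rho>p by auto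
  then have "\<forall>\<^sub>F t in at_right 0. 0 < \<rho> (p + t *\<^sub>R h)"
    unfolding eventually_at_right_field by blast
  with inW[of h] show "\<forall>\<^sub>F t in at_right 0. p + t *\<^sub>R h \<notin> D"
    by eventually_elim (simp add: D)
  have neg: "inner (- h) (gradient \<rho> p) < 0" using pos by simp
  obtain d' where "d' > 0" "\<And>t. 0 < t \<Longrightarrow> t < d' \<Longrightarrow> \<rho> (p + t *\<^sub>R (- h)) < 0"
    using DERIV_neg_dec_right[OF has_derivative_along_line[OF diff, of "- h"] neg] \<rho>p by auto
  then have "\<forall>\<^sub>F t in at_right 0. \<rho> (p + t *\<^sub>R (- h)) < 0"
    unfolding eventually_at_right_field by blast
  with inW[of "- h"] show "\<forall>\<^sub>F t in at_right 0. p + t *\<^sub>R (- h) \<in> D"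
    by eventually_elim (simp add: D)
qed

lemma norm_outer_normal:
  assumes "C2_boundary_point D p"
  shows "norm (outer_normal D p) = 1"
proof -
  obtain W \<rho> where p: "p \<in> frontier D" and \<rho>: "local_defining_function D p W \<rho>"
    using assms by (auto simp: C2_boundary_point_def)
  then have "gradient \<rho> p \<noteq> 0" by (auto simp: local_defining_function_def)
  then show ?thesis by (simp add: outer_normal_eq[OF p \<rho>])
qed

text \<open>If the radius to \<open>p\<close> were not along \<open>m\<close>, the difference of \<open>m\<close> and the unit radius
  would be a direction with positive \<open>m\<close>-component that enters the ball.\<close>

lemma radius_along_leaving_normal:
  fixes x p m :: "'a::euclidean_space"
  assumes r: "r > 0" "dist x p = r" and m: "norm m = 1"
    and leave: "\<And>h. inner h m > 0 \<Longrightarrow> \<forall>\<^sub>F t in at_right 0. p + t *\<^sub>R h \<notin> ball x r"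
  shows "p - x = r *\<^sub>R m"
proof (rule ccontr)
  assume ne: "p - x \<noteq> r *\<^sub>R m"
  define u where "u = (p - x) /\<^sub>R r"
  have px: "p - x = r *\<^sub>R u" using r by (simp add: u_def)
  have u: "norm u = 1" using r by (simp add: u_def dist_norm norm_minus_commute)
  have "u \<noteq> m" using ne px by auto
  define h where "h = m - u"
  define a where "a = 1 - inner u m"
  have uu: "inner u u = 1" "inner m m = 1" using u m by (simp_all add: norm_eq_1)
  have hh: "inner h h = 2 * a" and hm: "inner h m = a" and hu: "inner u h = - a"
    using uu by (simp_all add: h_def a_def inner_diff_left inner_diff_right inner_commute)
  have "inner h h > 0" using \<open>u \<noteq> m\<close> by (simp add: h_def)
  then have a: "a > 0" using hh by simp
  have "\<forall>\<^sub>F t in at_right 0. t \<in> {0<..<r}"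
    using r by (intro eventually_at_right_real) auto
  moreover have "\<forall>\<^sub>F t in at_right 0. p + t *\<^sub>R h \<notin> ball x r"
    using leave a hm by simp
  ultimately have "\<forall>\<^sub>F t in at_right (0::real). False"
  proof eventually_elim
    case (elim t)
    have "(norm (p + t *\<^sub>R h - x))\<^sup>2 = (norm (r *\<^sub>R u + t *\<^sub>R h))\<^sup>2"
      using px by (simp add: algebra_simps)
    also have "\<dots> = r\<^sup>2 - 2 * (t * (r - t) * a)"
      unfolding power2_norm_eq_inner
      by (simp add: inner_add_left inner_add_right uu hh hu inner_commute[of h u])
         (simp add: algebra_simps power2_eq_square)
    also have "\<dots> < r\<^sup>2" using elim a by simp
    finally have "norm (p + t *\<^sub>R h - x) < r" using r by (simp add: power_less_imp_less_base)
    then show False using elim by (simp add: dist_norm norm_minus_commute)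
  qed
  then show False by simp
qed

text \<open>The ball about \<open>x\<close> that reaches the boundary at \<open>p\<close> lies on one side of the boundary,
  hence is tangent to it there.\<close>

lemma nearest_point_along_normal:
  fixes D :: "'a::euclidean_space set"
  assumes "open D" and C2: "C2_boundary_point D p"
    and near: "dist x p = infdist x (frontier D)"
  shows "x = p + (if x \<in> D then - infdist x (frontier D) else infdist x (frontier D))
                   *\<^sub>R outer_normal D p"
proof -
  define r where "r = infdist x (frontier D)"
  obtain W \<rho> where p: "p \<in> frontier D" and \<rho>: "local_defining_function D p W \<rho>"
    using C2 by (auto simp: C2_boundary_point_def)
  have n: "norm (outer_normal D p) = 1" using norm_outer_normal[OF C2] .
  have disj: "ball x r \<inter> frontier D = {}"
    using infdist_le[of _ "frontier D" x] by (force simp: r_def)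
  show ?thesis
  proof (cases "r = 0")
    case True
    then have "x = p" using near by (simp add: r_def)
    then show ?thesis using True by (simp add: r_def)
  next
    case False
    then have r: "r > 0" using infdist_nonneg[of x "frontier D"] by (simp add: r_def)
    have dr: "dist x p = r" using near by (simp add: r_def)
    show ?thesis
    proof (cases "x \<in> D")
      case True
      have "ball x r \<subseteq> D"
        using connected_Int_frontier[of "ball x r" D] disj True r centre_in_ball by blast
      then have "p - x = r *\<^sub>R outer_normal D p"
        by (intro radius_along_leaving_normal[OF r dr n]
              eventually_mono[OF outward_direction_leaves(1)[OF p \<rho>]]) auto
      then show ?thesis using True by (simp add: r_def algebra_simps)
    next
      case False
      have out: "ball x r \<inter> D = {}"
        using connected_Int_frontier[of "ball x r" D] disj False r centre_in_ball by blast
      have "p - x = r *\<^sub>R (- outer_normal D p)"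
      proof (rule radius_along_leaving_normal[OF r dr])
        fix h assume "inner h (- outer_normal D p) > 0"
        then have "inner (- h) (outer_normal D p) > 0" by simp
        from outward_direction_leaves(2)[OF p \<rho> this]
        show "\<forall>\<^sub>F t in at_right 0. p + t *\<^sub>R h \<notin> ball x r"
          by (rule eventually_mono) (use out in auto)
      qed (use n in auto)
      then show ?thesis using False by (simp add: r_def algebra_simps)
    qed
  qed
qed

lemma closest_point_frontier:
  fixes D :: "'a::euclidean_space set"
  assumes "frontier D \<noteq> {}"
  shows "closest_point (frontier D) x \<in> frontier D"
    and "dist x (closest_point (frontier D) x) = infdist x (frontier D)"
proof -
  show mem: "closest_point (frontier D) x \<in> frontier D"
    using closest_point_in_set[OF frontier_closed assms] .
  obtain q where "q \<in> frontier D" "infdist x (frontier D) = dist x q"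
    using infdist_attains_inf[OF frontier_closed assms] by blast
  then show "dist x (closest_point (frontier D) x) = infdist x (frontier D)"
    using closest_point_le[OF frontier_closed, of q D x] infdist_le[OF mem, of x] by simp
qed

text \<open>Two nearest points \<open>p\<close>, \<open>q\<close> of \<open>x\<close> satisfy \<open>p - q = \<plusminus> \<delta> (n\<^sub>p - n\<^sub>q)\<close>
  with the same sign, as the sign only depends on the side on which \<open>x\<close> lies.  The Lipschitz
  bound on the normals then forces \<open>p = q\<close> once \<open>\<delta>\<close> is small.\<close>

lemma unique_projection_near_C2_point:
  fixes D :: "'a::euclidean_space set"
  assumes "open D" and \<rho>: "local_defining_function D \<xi> W \<rho>" and \<xi>: "\<xi> \<in> frontier D"
  obtains \<eta> where "\<eta> > 0" "\<And>x. x \<in> ball \<xi> \<eta> \<Longrightarrow> has_unique_C2_projection D x"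
proof -
  obtain L e where L: "L > 0" and e: "e > 0" and Lip:
    "\<And>p q. p \<in> frontier D \<inter> ball \<xi> e \<Longrightarrow> q \<in> frontier D \<inter> ball \<xi> e \<Longrightarrow>
       norm (outer_normal D p - outer_normal D q) \<le> L * dist p q"
    using outer_normal_Lipschitz[OF \<rho> \<xi>] by metis
  obtain w where w: "w > 0" "ball \<xi> w \<subseteq> W"
    using \<rho> open_contains_ball unfolding local_defining_function_def by blast
  define \<eta> where "\<eta> = min (min (e / 2) (w / 2)) (1 / (2 * L))"
  have \<eta>: "\<eta> > 0" "2 * \<eta> \<le> e" "2 * \<eta> \<le> w" "\<eta> \<le> 1 / (2 * L)" using e w L by (auto simp: \<eta>_def)
  have ne: "frontier D \<noteq> {}" using \<xi> by auto
  show thesis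
  proof
    show "\<eta> > 0" by (fact \<eta>)
    fix x assume x: "x \<in> ball \<xi> \<eta>"
    define s where "s = (if x \<in> D then - infdist x (frontier D) else infdist x (frontier D))"
    have small: "infdist x (frontier D) < \<eta>"
      using infdist_le[OF \<xi>, of x] x by (simp add: dist_commute)
    have loc: "p \<in> ball \<xi> (2 * \<eta>)" if "dist x p = infdist x (frontier D)" for p
      using that small x dist_triangle[of \<xi> p x] by simp
    have C2: "C2_boundary_point D p"
      if "p \<in> frontier D" "dist x p = infdist x (frontier D)" for p
      using that loc[of p] w \<eta> local_defining_function_moved[OF \<rho>, of p]
      unfolding C2_boundary_point_def by force
    have uniq: "p = q" if p: "p \<in> frontier D" "dist x p = infdist x (frontier D)"
      and q: "q \<in> frontier D" "dist x q = infdist x (frontier D)" for p q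
    proof -
      have "x = p + s *\<^sub>R outer_normal D p" "x = q + s *\<^sub>R outer_normal D q"
        unfolding s_def
        using nearest_point_along_normal[OF \<open>open D\<close> C2] p q by blast+
      then have "q - p = s *\<^sub>R (outer_normal D p - outer_normal D q)"
        by (simp add: algebra_simps)
      then have "dist p q = \<bar>s\<bar> * norm (outer_normal D p - outer_normal D q)"
        by (metis dist_commute dist_norm norm_scaleR)
      also have "\<dots> \<le> (1 / (2 * L)) * (L * dist p q)"
      proof (intro mult_mono Lip)
        show "\<bar>s\<bar> \<le> 1 / (2 * L)"
          using small \<eta>(4) infdist_nonneg[of x "frontier D"] by (simp add: s_def)
      qed (use p q loc[of p] loc[of q] \<eta> L in auto)
      also have "\<dots> = dist p q / 2" using L by simp
      finally show ?thesis by simp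
    qed
    show "has_unique_C2_projection D x"
      unfolding has_unique_C2_projection_def
      using closest_point_frontier[OF ne, of x] C2 uniq by (metis (lifting))
  qed
qed

section \<open>Segments near a supporting ball\<close>

text \<open>The endpoint inequality of a reparametrised segment, as a limit of the interior ones.  Clearing
  the denominator \<open>1 + c * t\<close> also covers unbounded segments, where \<open>1 + c = 0\<close>.\<close>

lemma quadratic_endpoint:
  fixes A B c G :: real
  assumes "\<And>t. 0 < t \<Longrightarrow> t < 1 \<Longrightarrow> A * t\<^sup>2 + B * t * (1 + c * t) \<le> G * (1 + c * t)\<^sup>2"
  shows "A + B * (1 + c) \<le> G * (1 + c)\<^sup>2"
proof -
  have "((\<lambda>t. G * (1 + c * t)\<^sup>2 - (A * t\<^sup>2 + B * t * (1 + c * t))) \<longlongrightarrow>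
          G * (1 + c * 1)\<^sup>2 - (A * 1\<^sup>2 + B * 1 * (1 + c * 1))) (at_left 1)"
    by (intro tendsto_intros)
  moreover have "\<forall>\<^sub>F t in at_left (1::real). t \<in> {0<..<1}"
    by (rule eventually_at_left_real) simp
  then have "\<forall>\<^sub>F t in at_left 1. 0 \<le> G * (1 + c * t)\<^sup>2 - (A * t\<^sup>2 + B * t * (1 + c * t))"
    by eventually_elim (use assms in auto)
  ultimately have "0 \<le> G * (1 + c * 1)\<^sup>2 - (A * 1\<^sup>2 + B * 1 * (1 + c * 1))"
    by (intro tendsto_lowerbound) auto
  then show ?thesis by simp
qed

text \<open>The vector has normal component \<open>\<alpha>\<close> and tangential length \<open>sqrt \<omega>\<close>; the two
  inequalities say that the endpoints of the segment, at parameters \<open>1 / (1 + c)\<close> and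
  \<open>- 1 / (1 - c)\<close>, lie in the closed ball of radius \<open>1 / (2 * \<kappa>)\<close> in which \<open>x\<close> has depth
  \<open>\<delta>\<close>.  The squared Hilbert metric of that ball is the quantity \<open>E\<close> below.  Completing the
  square in the inequalities gives \<open>E \<le> (1 + d)\<^sup>2\<close> and \<open>E \<le> (1 - d)\<^sup>2\<close> for the same
  \<open>d\<close>, whence \<open>E \<le> 1\<close> if \<open>\<bar>d\<bar> \<le> 1\<close>.\<close>

lemma ball_metric_estimate:
  fixes \<alpha> \<omega> \<kappa> \<delta> c :: real
  assumes \<kappa>: "\<kappa> > 0" and \<delta>: "\<delta> > 0" "\<kappa> * \<delta> < 1" and \<omega>: "\<omega> \<ge> 0" and c: "\<bar>c\<bar> \<le> 1"
    and plus: "\<kappa> * (\<alpha>\<^sup>2 + \<omega>) + \<alpha> * (1 - 2 * \<kappa> * \<delta>) * (1 + c)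
                 \<le> \<delta> * (1 - \<kappa> * \<delta>) * (1 + c)\<^sup>2"
    and minus: "\<kappa> * (\<alpha>\<^sup>2 + \<omega>) - \<alpha> * (1 - 2 * \<kappa> * \<delta>) * (1 - c)
                 \<le> \<delta> * (1 - \<kappa> * \<delta>) * (1 - c)\<^sup>2"
  shows "\<alpha>\<^sup>2 / (4 * \<delta>\<^sup>2) + \<kappa> * (\<omega> / \<delta>) \<le> 1"
proof -
  define \<gamma> b m where "\<gamma> = \<delta> * (1 - \<kappa> * \<delta>)" and "b = \<alpha> * (1 - 2 * \<kappa> * \<delta>) / (2 * \<gamma>)"
    and "m = \<kappa> * (\<alpha>\<^sup>2 + \<omega>) / \<gamma>"
  define E d where "E = b\<^sup>2 + m" and "d = c - b"
  have \<gamma>: "\<gamma> > 0" "\<gamma> \<le> \<delta>" using \<delta> \<kappa> by (auto simp: \<gamma>_def)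
  have b: "\<alpha> * (1 - 2 * \<kappa> * \<delta>) = \<gamma> * (2 * b)" and m: "\<kappa> * (\<alpha>\<^sup>2 + \<omega>) = \<gamma> * m"
    using \<gamma> by (simp_all add: b_def m_def)
  have "\<gamma> * (m + 2 * b * (1 + c)) \<le> \<gamma> * (1 + c)\<^sup>2"
    using plus unfolding b m \<gamma>_def[symmetric] by (simp add: algebra_simps)
  then have "m + 2 * b * (1 + c) \<le> (1 + c)\<^sup>2" using \<gamma>(1) by simp
  then have E1: "E \<le> (1 + d)\<^sup>2"
    by (simp add: E_def d_def power2_eq_square algebra_simps)
  have "\<gamma> * (m - 2 * b * (1 - c)) \<le> \<gamma> * (1 - c)\<^sup>2"
    using minus unfolding b m \<gamma>_def[symmetric] by (simp add: algebra_simps)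
  then have "m - 2 * b * (1 - c) \<le> (1 - c)\<^sup>2" using \<gamma>(1) by simp
  then have E2: "E \<le> (1 - d)\<^sup>2"
    by (simp add: E_def d_def power2_eq_square algebra_simps)
  have m0: "m \<ge> 0" using \<kappa> \<omega> \<gamma> by (simp add: m_def)
  show ?thesis
  proof (cases "\<bar>d\<bar> \<le> 1")
    case True
    have "E \<le> (1 - \<bar>d\<bar>)\<^sup>2" using E1 E2 by (cases "d \<ge> 0") auto
    also have "\<dots> \<le> 1" using True by (simp add: power_le_one)
    finally have "E \<le> 1" .
    \<comment> \<open>The term \<open>\<kappa> * \<alpha>\<^sup>2 / \<gamma>\<close> exactly compensates the loss in \<open>b\<^sup>2\<close>.\<close>
    have "4 * \<gamma>\<^sup>2 * (b\<^sup>2 + \<kappa> * \<alpha>\<^sup>2 / \<gamma>) = (\<gamma> * (2 * b))\<^sup>2 + 4 * \<gamma> * \<kappa> * \<alpha>\<^sup>2"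
      using \<gamma> by (simp add: power2_eq_square field_simps)
    also have "\<dots> = \<alpha>\<^sup>2"
      unfolding b[symmetric] by (simp add: \<gamma>_def power2_eq_square algebra_simps)
    finally have "b\<^sup>2 + \<kappa> * \<alpha>\<^sup>2 / \<gamma> = \<alpha>\<^sup>2 / (4 * \<gamma>\<^sup>2)"
      using \<gamma> by (simp add: field_simps)
    moreover have "\<alpha>\<^sup>2 / (4 * \<delta>\<^sup>2) \<le> \<alpha>\<^sup>2 / (4 * \<gamma>\<^sup>2)"
      using \<gamma> by (intro frac_le) auto
    moreover have "\<kappa> * (\<omega> / \<delta>) \<le> \<kappa> * \<omega> / \<gamma>"
      using \<gamma> \<kappa> \<omega> by (simp add: frac_le)
    moreover have "E = b\<^sup>2 + \<kappa> * \<alpha>\<^sup>2 / \<gamma> + \<kappa> * \<omega> / \<gamma>"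
      by (simp add: E_def m_def algebra_simps add_divide_distrib)
    ultimately show ?thesis using \<open>E \<le> 1\<close> by linarith
  next
    case False
    \<comment> \<open>Then \<open>E \<le> b\<^sup>2\<close>, which is possible only for the zero vector.\<close>
    have "(1 - \<bar>d\<bar>)\<^sup>2 \<le> b\<^sup>2"
      using False c unfolding d_def by (intro abs_le_square_iff[THEN iffD1]) linarith
    moreover have "E \<le> (1 - \<bar>d\<bar>)\<^sup>2" using E1 E2 by (cases "d \<ge> 0") auto
    ultimately have "m = 0" using m0 by (simp add: E_def)
    then have "\<alpha>\<^sup>2 + \<omega> = 0" using m \<kappa> by simp
    then have "\<alpha> = 0" "\<omega> = 0" using \<omega> by (auto simp: add_nonneg_eq_0_iff)
    then show ?thesis by simp
  qed
qed

lemma projective_denominator_pos: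
  fixes c t :: real
  assumes "\<bar>c\<bar> \<le> 1" "t \<in> {-1<..<1}"
  shows "1 + c * t > 0" and "1 + c * t < 2"
proof -
  have "\<bar>c\<bar> * \<bar>t\<bar> \<le> 1 * \<bar>t\<bar>" using assms by (intro mult_right_mono) auto
  also have "1 * \<bar>t\<bar> < 1" using assms(2) by auto
  finally have "\<bar>c * t\<bar> < 1" by (simp add: abs_mult)
  then show "1 + c * t > 0" "1 + c * t < 2" by linarith+
qed

text \<open>A segment of \<open>D\<close> through \<open>x\<close> cannot leave the neighbourhood of radius \<open>R\<close> on the side
  heading towards the boundary.  If it stays inside on the other side too, the estimate is that of
  the supporting ball.  If it leaves there, its direction makes a definite angle with the tangent
  plane, so the tangential term is dominated by the error allowed in the normal term, and the
  distance to the supporting hyperplane already bounds the latter.\<close>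

lemma segment_estimate_towards_boundary:
  fixes p n u :: "'a::euclidean_space"
  assumes n: "norm n = 1" and \<kappa>: "\<kappa> > 0" and R: "R > 0"
    and \<delta>: "\<delta> > 0" "2 * \<delta> \<le> \<kappa> * R\<^sup>2" "\<delta> \<le> R" "\<kappa> * \<delta> < 1"
    and supp: "\<And>y. y \<in> D \<Longrightarrow> norm (y - p) \<le> R \<Longrightarrow> inner (y - p) n \<le> - \<kappa> * (norm (y - p))\<^sup>2"
    and c: "\<bar>c\<bar> \<le> 1"
    and inD: "\<And>t. t \<in> {-1<..<1} \<Longrightarrow> p - \<delta> *\<^sub>R n + (t / (1 + c * t)) *\<^sub>R u \<in> D"
    and towards: "inner u n \<ge> 0"
  shows "(1 - 16 / (\<kappa> * R\<^sup>2) * \<delta>) * ((inner u n)\<^sup>2 / (4 * \<delta>\<^sup>2))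
           + \<kappa> * ((norm (u - inner u n *\<^sub>R n))\<^sup>2 / \<delta>) \<le> 1"
proof -
  define \<alpha> w where "\<alpha> = inner u n" and "w = u - \<alpha> *\<^sub>R n"
  define \<omega> where "\<omega> = (norm w)\<^sup>2"
  define s where "s t = t / (1 + c * t)" for t
  define f where "f t = p - \<delta> *\<^sub>R n + s t *\<^sub>R u" for t
  have den: "1 + c * t > 0" "1 + c * t < 2" if "t \<in> {-1<..<1}" for t
    using projective_denominator_pos[OF c that] by auto
  have nn: "inner n n = 1" using n by (simp add: norm_eq_1)
  have wn: "inner w n = 0" "inner n w = 0"
    by (simp_all add: w_def \<alpha>_def inner_diff_left inner_diff_right nn inner_commute)
  have \<alpha>0: "\<alpha> \<ge> 0" using towards by (simp add: \<alpha>_def)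
  have fp: "f t - p = (s t * \<alpha> - \<delta>) *\<^sub>R n + s t *\<^sub>R w" for t
    by (simp add: f_def w_def algebra_simps)
  have fn: "inner (f t - p) n = s t * \<alpha> - \<delta>" for t
    by (simp add: fp inner_add_left nn wn)
  have fnorm: "(norm (f t - p))\<^sup>2 = (s t * \<alpha> - \<delta>)\<^sup>2 + (s t)\<^sup>2 * \<omega>" for t
    unfolding fp power2_norm_eq_inner \<omega>_def
    by (simp add: inner_add_left inner_add_right nn wn power2_eq_square)
  have S: "s t * \<alpha> - \<delta> \<le> - \<kappa> * (norm (f t - p))\<^sup>2"
    if "t \<in> {-1<..<1}" "norm (f t - p) \<le> R" for t
    using supp[of "f t"] inD[OF that(1)] that(2) by (simp add: fn) (simp add: f_def s_def)
  have cont: "continuous_on {a..b} (\<lambda>t. norm (f t - p))" if "- 1 < a" "b < 1" for a b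
  proof -
    have "1 + c * t \<noteq> 0" if "t \<in> {a..b}" for t
      using den(1)[of t] that \<open>- 1 < a\<close> \<open>b < 1\<close> by auto
    then show ?thesis unfolding f_def s_def by (intro continuous_intros ballI)
  qed
  have f0: "norm (f 0 - p) = \<delta>" using \<delta> n by (simp add: f_def s_def)
  have fwd: "norm (f t - p) \<le> R" if t: "0 \<le> t" "t < 1" for t
  proof (rule ccontr)
    assume "\<not> norm (f t - p) \<le> R"
    then obtain t' where t': "0 \<le> t'" "t' \<le> t" "norm (f t' - p) = R"
      using IVT'[of "\<lambda>t. norm (f t - p)" 0 R t] f0 \<delta> t cont[of 0 t] by auto
    then have "t' \<in> {-1<..<1}" using t by auto
    then have "s t' * \<alpha> - \<delta> \<le> - \<kappa> * R\<^sup>2" "s t' \<ge> 0"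
      using S[of t'] t' den[of t'] by (auto simp: s_def)
    then show False using \<alpha>0 \<delta> mult_nonneg_nonneg[of "s t'" \<alpha>] by linarith
  qed
  have "t * \<alpha> \<le> 2 * \<delta>" if t: "0 < t" "t < 1" for t
  proof -
    have I: "t \<in> {-1<..<1}" using t by auto
    have "s t * \<alpha> - \<delta> \<le> - \<kappa> * (norm (f t - p))\<^sup>2" using S[OF I fwd] t by simp
    moreover have "\<kappa> * (norm (f t - p))\<^sup>2 \<ge> 0" using \<kappa> by simp
    ultimately have "s t * \<alpha> \<le> \<delta>" by simp
    then have "t * \<alpha> \<le> \<delta> * (1 + c * t)"
      using den[OF I] by (simp add: s_def field_simps)
    also have "\<dots> \<le> \<delta> * 2" using den[OF I] \<delta> by (intro mult_left_mono) auto
    finally show ?thesis by simp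
  qed
  then have \<alpha>2: "\<alpha> \<le> 2 * \<delta>" by (rule field_le_mult_one_interval)
  have quad: "\<kappa> * (\<alpha>\<^sup>2 + \<omega>) * t\<^sup>2 + \<alpha> * (1 - 2 * \<kappa> * \<delta>) * t * (1 + c * t)
      \<le> \<delta> * (1 - \<kappa> * \<delta>) * (1 + c * t)\<^sup>2"
    if I: "t \<in> {-1<..<1}" and "norm (f t - p) \<le> R" for t
  proof -
    define q where "q = 1 + c * t"
    have q: "q > 0" and tq: "t = s t * q" using den[OF I] by (simp_all add: q_def s_def)
    have "\<kappa> * (\<alpha>\<^sup>2 + \<omega>) * (s t)\<^sup>2 + \<alpha> * (1 - 2 * \<kappa> * \<delta>) * s t \<le> \<delta> * (1 - \<kappa> * \<delta>)"
      using S[OF that] unfolding fnorm by (simp add: power2_eq_square algebra_simps)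
    from mult_right_mono[OF this, of "q\<^sup>2"] q
    have "\<kappa> * (\<alpha>\<^sup>2 + \<omega>) * (s t * q)\<^sup>2 + \<alpha> * (1 - 2 * \<kappa> * \<delta>) * (s t * q) * q
      \<le> \<delta> * (1 - \<kappa> * \<delta>) * q\<^sup>2"
      by (simp add: power2_eq_square algebra_simps)
    then show ?thesis unfolding tq[symmetric] unfolding q_def .
  qed
  have \<alpha>sq: "\<alpha>\<^sup>2 / (4 * \<delta>\<^sup>2) \<le> 1"
  proof -
    have "\<alpha>\<^sup>2 \<le> (2 * \<delta>)\<^sup>2" using \<alpha>2 \<alpha>0 by (rule power_mono)
    then show ?thesis using \<delta> by (simp add: power_mult_distrib)
  qed
  have "(1 - 16 / (\<kappa> * R\<^sup>2) * \<delta>) * (\<alpha>\<^sup>2 / (4 * \<delta>\<^sup>2)) + \<kappa> * (\<omega> / \<delta>) \<le> 1"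
  proof (cases "\<forall>t\<in>{-1<..0}. norm (f t - p) \<le> R")
    case True
    have "\<kappa> * (\<alpha>\<^sup>2 + \<omega>) + \<alpha> * (1 - 2 * \<kappa> * \<delta>) * (1 + c) \<le> \<delta> * (1 - \<kappa> * \<delta>) * (1 + c)\<^sup>2"
      by (rule quadratic_endpoint) (use quad fwd in auto)
    moreover have "\<kappa> * (\<alpha>\<^sup>2 + \<omega>) + (- (\<alpha> * (1 - 2 * \<kappa> * \<delta>))) * (1 + (- c))
        \<le> \<delta> * (1 - \<kappa> * \<delta>) * (1 + (- c))\<^sup>2"
    proof (rule quadratic_endpoint)
      fix t :: real assume "0 < t" "t < 1"
      then show "\<kappa> * (\<alpha>\<^sup>2 + \<omega>) * t\<^sup>2 + (- (\<alpha> * (1 - 2 * \<kappa> * \<delta>))) * t * (1 + (- c) * t)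
          \<le> \<delta> * (1 - \<kappa> * \<delta>) * (1 + (- c) * t)\<^sup>2"
        using quad[of "- t"] True by simp
    qed
    ultimately have "\<alpha>\<^sup>2 / (4 * \<delta>\<^sup>2) + \<kappa> * (\<omega> / \<delta>) \<le> 1"
      using ball_metric_estimate[OF \<kappa> \<delta>(1,4) _ c, of \<omega> \<alpha>] by (simp add: \<omega>_def)
    moreover have "16 / (\<kappa> * R\<^sup>2) * \<delta> * (\<alpha>\<^sup>2 / (4 * \<delta>\<^sup>2)) \<ge> 0"
      using \<kappa> \<delta> by simp
    ultimately show ?thesis unfolding left_diff_distrib by linarith
  next
    case False
    then obtain t where t: "-1 < t" "t \<le> 0" "norm (f t - p) \<ge> R" by force
    obtain t' where t': "t \<le> t'" "t' \<le> 0" "norm (f t' - p) = R"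
      using IVT2'[of "\<lambda>t. norm (f t - p)" 0 R t] f0 \<delta> t cont[of t 0] by auto
    have I: "t' \<in> {-1<..<1}" using t t' by auto
    define \<sigma> where "\<sigma> = - s t'"
    have \<sigma>0: "\<sigma> \<ge> 0" using t' den[OF I] by (simp add: \<sigma>_def s_def divide_nonpos_pos)
    have "s t' * \<alpha> - \<delta> \<le> - \<kappa> * R\<^sup>2" using S[OF I] t' by simp
    then have \<sigma>\<alpha>: "\<kappa> * R\<^sup>2 / 2 \<le> \<sigma> * \<alpha>" using \<delta> by (simp add: \<sigma>_def)
    have "(\<sigma> * norm w)\<^sup>2 \<le> R\<^sup>2"
      using fnorm[of t'] unfolding t'(3) by (simp add: \<sigma>_def \<omega>_def power_mult_distrib)
    then have \<sigma>w: "\<sigma> * norm w \<le> R" by (rule power2_le_imp_le) (use R in simp)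
    have "\<kappa> * R\<^sup>2 / 2 * norm w \<le> \<sigma> * \<alpha> * norm w" using \<sigma>\<alpha> by (intro mult_right_mono) auto
    also have "\<dots> = (\<sigma> * norm w) * \<alpha>" by simp
    also have "\<dots> \<le> R * \<alpha>" using \<sigma>w \<alpha>0 by (rule mult_right_mono)
    finally have "R * (\<kappa> * R * norm w) \<le> R * (2 * \<alpha>)" by (simp add: power2_eq_square algebra_simps)
    then have "\<kappa> * R * norm w \<le> 2 * \<alpha>" using R by simp
    then have "(\<kappa> * R * norm w)\<^sup>2 \<le> (2 * \<alpha>)\<^sup>2" using \<kappa> R by (intro power_mono) auto
    then have "\<kappa> * (\<kappa> * R\<^sup>2 * \<omega>) \<le> 4 * \<alpha>\<^sup>2"
      by (simp add: \<omega>_def power_mult_distrib) (simp add: power2_eq_square algebra_simps)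
    then have "\<kappa> * (\<omega> / \<delta>) \<le> 4 * \<alpha>\<^sup>2 / (\<kappa> * R\<^sup>2 * \<delta>)"
      using \<kappa> R \<delta> by (simp add: field_simps)
    also have "\<dots> = 16 / (\<kappa> * R\<^sup>2) * \<delta> * (\<alpha>\<^sup>2 / (4 * \<delta>\<^sup>2))"
      using \<kappa> R \<delta> by (simp add: field_simps power2_eq_square)
    finally show ?thesis using \<alpha>sq unfolding left_diff_distrib by linarith
  qed
  then show ?thesis by (simp add: \<alpha>_def \<omega>_def w_def)
qed

lemma segment_estimate:
  fixes p n u :: "'a::euclidean_space"
  assumes n: "norm n = 1" and \<kappa>: "\<kappa> > 0" and R: "R > 0"
    and \<delta>: "\<delta> > 0" "2 * \<delta> \<le> \<kappa> * R\<^sup>2" "\<delta> \<le> R" "\<kappa> * \<delta> < 1"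
    and supp: "\<And>y. y \<in> D \<Longrightarrow> norm (y - p) \<le> R \<Longrightarrow> inner (y - p) n \<le> - \<kappa> * (norm (y - p))\<^sup>2"
    and c: "\<bar>c\<bar> \<le> 1"
    and inD: "\<And>t. t \<in> {-1<..<1} \<Longrightarrow> p - \<delta> *\<^sub>R n + (t / (1 + c * t)) *\<^sub>R u \<in> D"
  shows "(1 - 16 / (\<kappa> * R\<^sup>2) * \<delta>) * ((inner u n)\<^sup>2 / (4 * \<delta>\<^sup>2))
           + \<kappa> * ((norm (u - inner u n *\<^sub>R n))\<^sup>2 / \<delta>) \<le> 1"
proof (cases "inner u n \<ge> 0")
  case True
  show ?thesis
    by (rule segment_estimate_towards_boundary[OF n \<kappa> R \<delta> supp c inD True])
next
  case False
  \<comment> \<open>Traverse the segment in the opposite direction.\<close>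
  have "norm (- u - inner (- u) n *\<^sub>R n) = norm (u - inner u n *\<^sub>R n)"
    using norm_minus_cancel[of "u - inner u n *\<^sub>R n"] by simp
  moreover have "p - \<delta> *\<^sub>R n + (t / (1 + (- c) * t)) *\<^sub>R (- u) \<in> D" if "t \<in> {-1<..<1}" for t
    using inD[of "- t"] that by simp
  ultimately show ?thesis
    using segment_estimate_towards_boundary[OF n \<kappa> R \<delta> supp, where c = "- c" and u = "- u"] c False by simp
qed

section \<open>The Kobayashi--Hilbert metric near the boundary\<close>

lemma projective_map_line:
  fixes f :: "real \<Rightarrow> 'a::euclidean_space"
  assumes f: "projective_map f" and der: "(f has_vector_derivative w) (at 0)"
  obtains c where "\<bar>c\<bar> \<le> 1" "\<And>t. t \<in> {-1<..<1} \<Longrightarrow> f t = f 0 + (t / (1 + c * t)) *\<^sub>R w"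
proof -
  obtain a b c where abc: "\<And>t. t \<in> {-1<..<1} \<Longrightarrow>
      1 + c * t \<noteq> 0 \<and> f t = (a + t *\<^sub>R b) /\<^sub>R (1 + c * t)"
    using f unfolding projective_map_def by blast
  have c: "\<bar>c\<bar> \<le> 1"
  proof (rule ccontr)
    assume "\<not> \<bar>c\<bar> \<le> 1"
    then have "- 1 / c \<in> {-1<..<1}" "c \<noteq> 0" by (auto simp: field_simps abs_if split: if_splits)
    then show False using abc[of "- 1 / c"] by simp
  qed
  have f0: "f 0 = a" using abc[of 0] by simp
  define w' where "w' = b - c *\<^sub>R a"
  have line: "f t = a + (t / (1 + c * t)) *\<^sub>R w'" if "t \<in> {-1<..<1}" for t
  proof -
    have "(1 + c * t) *\<^sub>R (a + (t / (1 + c * t)) *\<^sub>R w') = a + t *\<^sub>R b"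
      using abc[OF that] by (simp add: w'_def scaleR_add_right) (simp add: algebra_simps)
    then show ?thesis using abc[OF that] by (metis scaleR_left_imp_eq scaleR_one scaleR_scaleR right_inverse)
  qed
  have "((\<lambda>t. t / (1 + c * t)) has_real_derivative 1) (at 0)"
    by (auto intro!: derivative_eq_intros)
  then have "((\<lambda>t. (t / (1 + c * t)) *\<^sub>R w') has_vector_derivative 1 *\<^sub>R w') (at 0)"
    using has_vector_derivative_scaleR[OF _ has_vector_derivative_const, of _ _ _ _ w'] by force
  then have "((\<lambda>t. a + (t / (1 + c * t)) *\<^sub>R w') has_vector_derivative w') (at 0)"
    using has_vector_derivative_add[OF has_vector_derivative_const] by force
  then have "(f has_vector_derivative w') (at 0)"
    by (rule has_vector_derivative_transform_within_open[of _ _ _ "{-1<..<1}"]) (use line in auto)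
  then have "w' = w" using der vector_derivative_unique_at by blast
  then show thesis using that[OF c] line f0 by simp
qed

text \<open>Openness of \<open>D\<close> makes the set of competitors nonempty, so that its infimum is genuine.\<close>

lemma kobayashi_hilbert_lower_bound:
  fixes D :: "'a::euclidean_space set"
  assumes "open D" "x \<in> D"
    and bound: "\<And>c r. r \<noteq> 0 \<Longrightarrow> \<bar>c\<bar> \<le> 1 \<Longrightarrow>
      (\<And>t. t \<in> {-1<..<1} \<Longrightarrow> x + (t / (1 + c * t)) *\<^sub>R (r *\<^sub>R v) \<in> D) \<Longrightarrow> m \<le> 1 / \<bar>r\<bar>"
  shows "m \<le> kobayashi_hilbert D x v"
  unfolding kobayashi_hilbert_def
proof (rule cInf_greatest)
  obtain e where e: "e > 0" "ball x e \<subseteq> D" using assms open_contains_ball by blast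
  define r where "r = e / (1 + norm v)"
  define f where "f t = x + t *\<^sub>R (r *\<^sub>R v)" for t
  have nv: "1 + norm v > 0" by (simp add: add_pos_nonneg)
  have r: "r > 0" using e nv by (simp add: r_def)
  have "projective_map f"
    unfolding projective_map_def f_def
    by (rule exI[of _ x], rule exI[of _ "r *\<^sub>R v"], rule exI[of _ 0]) simp
  moreover have "f ` {-1<..<1} \<subseteq> D"
  proof clarify
    fix t :: real assume t: "t \<in> {-1<..<1}"
    have "\<bar>t\<bar> * (r * norm v) \<le> 1 * (r * norm v)" using t r by (intro mult_right_mono) auto
    also have "\<dots> < r * (1 + norm v)" using r by simp
    also have "\<dots> = e" using nv by (simp add: r_def)
    finally have "f t \<in> ball x e" using r by (simp add: f_def dist_norm abs_mult)
    then show "f t \<in> D" using e by blast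
  qed
  moreover have "(f has_vector_derivative r *\<^sub>R v) (at 0)"
    unfolding f_def has_vector_derivative_def by (auto intro!: derivative_eq_intros)
  moreover have "f 0 = x" by (simp add: f_def)
  ultimately show "{1 / \<bar>r\<bar> | r f. r \<noteq> 0 \<and> projective_map f \<and> f ` {-1<..<1} \<subseteq> D \<and>
      f 0 = x \<and> (f has_vector_derivative r *\<^sub>R v) (at 0)} \<noteq> {}" (is "?S \<noteq> {}")
  proof -
    assume *: "projective_map f" "f ` {-1<..<1} \<subseteq> D"
      "(f has_vector_derivative r *\<^sub>R v) (at 0)" "f 0 = x"
    have "1 / \<bar>r\<bar> \<in> ?S"
      by (rule CollectI, rule exI[of _ r], rule exI[of _ f]) (use * r in simp)
    then show "?S \<noteq> {}" by (metis empty_iff)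
  qed
next
  fix k assume "k \<in> {1 / \<bar>r\<bar> | r f. r \<noteq> 0 \<and> projective_map f \<and> f ` {-1<..<1} \<subseteq> D \<and>
      f 0 = x \<and> (f has_vector_derivative r *\<^sub>R v) (at 0)}"
  then obtain r f where k: "k = 1 / \<bar>r\<bar>" "r \<noteq> 0" and f: "projective_map f"
    "f ` {-1<..<1} \<subseteq> D" "f 0 = x" "(f has_vector_derivative r *\<^sub>R v) (at 0)" by blast
  obtain c where "\<bar>c\<bar> \<le> 1"
    "\<And>t. t \<in> {-1<..<1} \<Longrightarrow> f t = x + (t / (1 + c * t)) *\<^sub>R (r *\<^sub>R v)"
    using projective_map_line[OF f(1,4)] f(3) by metis
  then show "m \<le> k" using bound[of r c] k f(2) by force
qed

theorem proposition4p7: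
  fixes D :: "'a::euclidean_space set" and \<xi> :: 'a
  assumes "DIM('a) \<ge> 2"
    and "open D" and "connected D"
    and "strongly_convex_boundary_point D \<xi>"
  shows "\<exists>U c\<^sub>1 c\<^sub>2. open U \<and> \<xi> \<in> U \<and> c\<^sub>1 > 0 \<and> c\<^sub>2 > 0 \<and>
           (\<forall>x\<in>U. has_unique_C2_projection D x) \<and>
           (\<forall>x\<in>D \<inter> U. \<forall>v.
              kobayashi_hilbert D x v \<ge>
                sqrt ((1 - c\<^sub>1 * boundary_dist D x) *
                        ((norm (normal_part D x v))\<^sup>2 / (4 * (boundary_dist D x)\<^sup>2))
                      + c\<^sub>2 * ((norm (tangential_part D x v))\<^sup>2 / boundary_dist D x)))"
proof -
  obtain W \<rho> where \<xi>: "\<xi> \<in> frontier D" and \<rho>: "local_defining_function D \<xi> W \<rho>"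
    and pos: "\<forall>v\<in>tangent_space D \<xi>. v \<noteq> 0 \<longrightarrow> inner (hessian \<rho> \<xi> v) v > 0"
    using assms(4) unfolding strongly_convex_boundary_point_def by blast
  have ne: "frontier D \<noteq> {}" using \<xi> by auto
  obtain \<kappa> e where \<kappa>: "\<kappa> > 0" and e: "e > 0"
    and supp: "\<And>p y. p \<in> frontier D \<inter> ball \<xi> e \<Longrightarrow> y \<in> D \<inter> ball \<xi> e \<Longrightarrow>
       inner (y - p) (outer_normal D p) \<le> - \<kappa> * (norm (y - p))\<^sup>2"
    using uniformly_supporting_balls[OF \<rho> \<xi> pos] by metis
  obtain \<eta> where \<eta>: "\<eta> > 0" "\<And>x. x \<in> ball \<xi> \<eta> \<Longrightarrow> has_unique_C2_projection D x"
    using unique_projection_near_C2_point[OF \<open>open D\<close> \<rho> \<xi>] by blast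
  define R where "R = e / 2"
  have R: "R > 0" using e by (simp add: R_def)
  define l where "l = min (min \<eta> (R / 2)) (min (\<kappa> * R\<^sup>2 / 2) (1 / \<kappa>))"
  have l: "l > 0" "l \<le> \<eta>" "2 * l \<le> R" "2 * l \<le> \<kappa> * R\<^sup>2" "l \<le> 1 / \<kappa>"
    using \<eta> R \<kappa> by (auto simp: l_def)
  define c\<^sub>1 where "c\<^sub>1 = 16 / (\<kappa> * R\<^sup>2)"
  have "sqrt ((1 - c\<^sub>1 * boundary_dist D x) *
            ((norm (normal_part D x v))\<^sup>2 / (4 * (boundary_dist D x)\<^sup>2))
          + \<kappa> * ((norm (tangential_part D x v))\<^sup>2 / boundary_dist D x))
        \<le> kobayashi_hilbert D x v" if x: "x \<in> D" "x \<in> ball \<xi> l" for x v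
  proof -
    define p n \<delta> where "p = closest_point (frontier D) x" and "n = outer_normal D p"
      and "\<delta> = boundary_dist D x"
    have p: "p \<in> frontier D" "dist x p = \<delta>"
      using closest_point_frontier[OF ne, of x] by (auto simp: p_def \<delta>_def boundary_dist_def)
    have C2: "C2_boundary_point D p"
      using \<eta>(2)[of x] x l unfolding has_unique_C2_projection_def p_def by auto
    have n: "norm n = 1" using norm_outer_normal[OF C2] by (simp add: n_def)
    have xp: "x = p - \<delta> *\<^sub>R n"
      using nearest_point_along_normal[OF \<open>open D\<close> C2, of x] p x
      by (simp add: \<delta>_def n_def boundary_dist_def)
    have "x \<notin> frontier D" using x \<open>open D\<close> by (simp add: frontier_def interior_open)
    then have "\<delta> > 0" using p by (metis dist_pos_lt)
    have "\<delta> < l"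
      using infdist_le[OF \<xi>, of x] x by (simp add: \<delta>_def boundary_dist_def dist_commute)
    have \<delta>: "\<delta> > 0" "2 * \<delta> \<le> \<kappa> * R\<^sup>2" "\<delta> \<le> R" "\<kappa> * \<delta> < 1"
      using \<open>\<delta> > 0\<close> \<open>\<delta> < l\<close> l \<kappa> R less_le_trans[OF \<open>\<delta> < l\<close> l(5)] by (auto simp: field_simps)
    have pe: "dist \<xi> p < R"
      using dist_triangle[of \<xi> p x] x p \<open>\<delta> < l\<close> l by simp
    have supp': "inner (y - p) n \<le> - \<kappa> * (norm (y - p))\<^sup>2" if "y \<in> D" "norm (y - p) \<le> R" for y
    proof -
      have "y \<in> ball \<xi> e"
        using that(2) pe dist_triangle[of \<xi> y p] by (simp add: R_def dist_norm norm_minus_commute)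
      then show ?thesis using supp[of p y] that p pe e by (simp add: n_def R_def)
    qed
    define X where "X v = (1 - c\<^sub>1 * \<delta>) * ((inner v n)\<^sup>2 / (4 * \<delta>\<^sup>2))
           + \<kappa> * ((norm (v - inner v n *\<^sub>R n))\<^sup>2 / \<delta>)" for v
    have scale: "X (r *\<^sub>R v) = r\<^sup>2 * X v" for r
    proof -
      have "r *\<^sub>R v - inner (r *\<^sub>R v) n *\<^sub>R n = r *\<^sub>R (v - inner v n *\<^sub>R n)"
        by (simp add: algebra_simps)
      then have "(norm (r *\<^sub>R v - inner (r *\<^sub>R v) n *\<^sub>R n))\<^sup>2 = r\<^sup>2 * (norm (v - inner v n *\<^sub>R n))\<^sup>2"
        by (simp add: power_mult_distrib)
      then show ?thesis unfolding X_def by (simp add: power_mult_distrib algebra_simps)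
    qed
    have "sqrt (X v) \<le> kobayashi_hilbert D x v"
    proof (rule kobayashi_hilbert_lower_bound[OF \<open>open D\<close> x(1)])
      fix c r :: real
      assume r: "r \<noteq> 0" and c: "\<bar>c\<bar> \<le> 1"
        and inD: "\<And>t. t \<in> {-1<..<1} \<Longrightarrow> x + (t / (1 + c * t)) *\<^sub>R (r *\<^sub>R v) \<in> D"
      have "X (r *\<^sub>R v) \<le> 1"
        unfolding X_def c\<^sub>1_def
        by (rule segment_estimate[OF n \<kappa> R \<delta> supp' c]) (use inD xp in auto)
      then have "X v \<le> 1 / r\<^sup>2" using r by (simp add: scale field_simps)
      then have "sqrt (X v) \<le> sqrt (1 / r\<^sup>2)" by (rule real_sqrt_le_mono)
      then show "sqrt (X v) \<le> 1 / \<bar>r\<bar>" by (simp add: real_sqrt_divide)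
    qed
    then show ?thesis
      using n by (simp add: X_def normal_part_def tangential_part_def Let_def
          flip: p_def n_def \<delta>_def)
  qed
  moreover have "c\<^sub>1 > 0" using \<kappa> R by (simp add: c\<^sub>1_def)
  ultimately show ?thesis
    using l \<eta> \<kappa> by (intro exI[of _ "ball \<xi> l"] exI[of _ c\<^sub>1] exI[of _ \<kappa>]) auto
qed

end
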